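(* Let $d,k\geq 2$ be arbitrary but fixed positive integers. Then the minimum number of copies of the binary caterpillar $F^2_k$ in an arbitrary $n$-leaf $d$-ary tree satisfies $$\min_{\substack{|T|=n\\ T\ d\text{-ary tree}}} c(F^2_k,T)=\frac{ n^{k}}{2} \cdot (d-1)^{k-1} \cdot \prod_{j=1}^{k-1}(d^j-1)^{-1} + \mathcal{O} (n^{k-1})$$ as $n \to \infty$.
   Context: All trees are finite rooted (unordered) trees, considered up to isomorphism of rooted trees. For an integer $d\ge 2$, a $d$-ary tree is a rooted tree in which each non-leaf vertex has outdegree (number of children) at least $2$ and at most $d$; the single vertex is the tree with one leaf. A binary tree is a $d$-ary tree with $d=2$. $|T|$ denotes the number of leaves of $T$. Given a nonempty set $L$ of leaves of $T$, the tree induced by $L$ is obtained by taking the minimal subtree of $T$ containing all leaves in $L$ (rooted at its vertex closest to the root of $T$) and then erasing (suppressing) all vertices of outdegree $1$. For $d$-ary trees $D$ and $T$, $c(D,T)$, the number of copies of $D$ in $T$, is the number of $|D|$-element subsets of leaves of $T$ that induce a tree isomorphic to $D$. The binary caterpillar $F^2_k$ is the binary tree with $k$ leaves whose non-leaf vertices form a path starting at the root. Since $d$ and $k$ are fixed, the implied constant in $\mathcal{O}$ may depend on $d$ and $k$. *)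

theory Defs
  imports Complex_Main "HOL-Library.Sublist" "HOL-Library.Landau_Symbols"
begin

text \<open>
  A finite rooted tree is given with some ordering of the children of each vertex; the ordering is
  disregarded by \<open>isomorphic\<close>. A vertex is identified with its address, i.e. the list of child
  indices on the path leading to it from the root (so the root is \<open>[]\<close>).
\<close>

datatype rtree = Node (children: "rtree list")

primrec subtree_at :: "rtree \<Rightarrow> nat list \<Rightarrow> rtree" where
  "subtree_at t [] = t"
| "subtree_at t (i # p) = subtree_at (children t ! i) p"

primrec is_vertex :: "rtree \<Rightarrow> nat list \<Rightarrow> bool" where
  "is_vertex t [] \<longleftrightarrow> True"
| "is_vertex t (i # p) \<longleftrightarrow> i < length (children t) \<and> is_vertex (children t ! i) p"

definition vertices :: "rtree \<Rightarrow> nat list set" where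
  "vertices t = {p. is_vertex t p}"

definition outdegree :: "rtree \<Rightarrow> nat list \<Rightarrow> nat" where
  "outdegree t p = length (children (subtree_at t p))"

definition leaves :: "rtree \<Rightarrow> nat list set" where
  "leaves t = {p \<in> vertices t. outdegree t p = 0}"

definition num_leaves :: "rtree \<Rightarrow> nat" where
  "num_leaves t = card (leaves t)"

definition dary :: "nat \<Rightarrow> rtree \<Rightarrow> bool" where
  "dary d t \<longleftrightarrow> (\<forall>p \<in> vertices t - leaves t. 2 \<le> outdegree t p \<and> outdegree t p \<le> d)"

definition is_child :: "nat list \<Rightarrow> nat list \<Rightarrow> bool" where
  "is_child q p \<longleftrightarrow> (\<exists>i. q = p @ [i])"

definition isomorphic :: "rtree \<Rightarrow> rtree \<Rightarrow> bool" where
  "isomorphic t u \<longleftrightarrow> (\<exists>f. bij_betw f (vertices t) (vertices u) \<and> f [] = [] \<and>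
     (\<forall>p \<in> vertices t. \<forall>q \<in> vertices t. is_child q p \<longleftrightarrow> is_child (f q) (f p)))"

text \<open>The union of all paths from the root to the vertices in \<open>L\<close>.\<close>

function prune :: "rtree \<Rightarrow> nat list set \<Rightarrow> rtree" where
  "prune (Node ts) L =
     Node (map (\<lambda>i. prune (ts ! i) {p. i # p \<in> L}) (filter (\<lambda>i. \<exists>p. i # p \<in> L) [0..<length ts]))"
  by pat_completeness auto
termination
  by (relation "measure (\<lambda>(t, L). size t)")
     (auto intro!: le_imp_less_Suc size_list_estimation' nth_mem)

text \<open>
  The vertex closest to the root in the minimal subtree containing \<open>L\<close> is the lowest common
  ancestor of \<open>L\<close>, whose address is the longest common prefix of the addresses in \<open>L\<close>.
\<close>

definition minimal_subtree :: "rtree \<Rightarrow> nat list set \<Rightarrow> rtree" where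
  "minimal_subtree t L =
     (let r = Longest_common_prefix L in prune (subtree_at t r) {p. r @ p \<in> L})"

fun suppress :: "rtree \<Rightarrow> rtree" where
  "suppress (Node []) = Node []"
| "suppress (Node [t]) = suppress t"
| "suppress (Node (t # u # ts)) = Node (map suppress (t # u # ts))"

definition induced :: "rtree \<Rightarrow> nat list set \<Rightarrow> rtree" where
  "induced t L = suppress (minimal_subtree t L)"

definition copies :: "rtree \<Rightarrow> rtree \<Rightarrow> nat" where
  "copies D T = card {L. L \<subseteq> leaves T \<and> card L = num_leaves D \<and> isomorphic (induced T L) D}"

text \<open>
  \<open>caterpillar k\<close> has \<open>k\<close> leaves for \<open>k \<ge> 1\<close>; the value at \<open>0\<close> is irrelevant.
\<close>

fun caterpillar :: "nat \<Rightarrow> rtree" where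
  "caterpillar 0 = Node []"
| "caterpillar (Suc 0) = Node []"
| "caterpillar (Suc (Suc k)) = Node [Node [], caterpillar (Suc k)]"

lemma vertices_Node:
  "vertices (Node ts) = insert [] (\<Union>i<length ts. (#) i ` vertices (ts ! i))"
proof (intro set_eqI)
  fix p show "p \<in> vertices (Node ts) \<longleftrightarrow> p \<in> insert [] (\<Union>i<length ts. (#) i ` vertices (ts ! i))"
    by (cases p) (auto simp: vertices_def)
qed

lemma leaves_Node:
  "leaves (Node ts) = (if ts = [] then {[]} else (\<Union>i<length ts. (#) i ` leaves (ts ! i)))"
  by (auto simp: leaves_def vertices_Node outdegree_def)

lemma finite_vertices: "finite (vertices t)"
  by (induction t) (auto simp: vertices_Node)

lemma finite_leaves: "finite (leaves t)"
  by (rule finite_subset[OF _ finite_vertices]) (auto simp: leaves_def)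

lemma dary_Node:
  "dary d (Node ts) \<longleftrightarrow>
     (ts = [] \<or> 2 \<le> length ts \<and> length ts \<le> d) \<and> (\<forall>i<length ts. dary d (ts ! i))"
proof -
  have *: "dary d t \<longleftrightarrow>
      (\<forall>p \<in> vertices t. outdegree t p = 0 \<or> 2 \<le> outdegree t p \<and> outdegree t p \<le> d)" for t
    unfolding dary_def leaves_def by blast
  show ?thesis
    unfolding * vertices_Node by (auto simp: outdegree_def)
qed

text \<open>
  The caterpillar is a binary tree with \<open>k\<close> leaves whose non-leaf vertices form a path starting
  at the root.
\<close>

lemma num_leaves_caterpillar: "k \<ge> 1 \<Longrightarrow> num_leaves (caterpillar k) = k"
proof (induction k rule: caterpillar.induct)
  case (3 k)
  have "leaves (caterpillar (Suc (Suc k))) = insert [0] ((#) 1 ` leaves (caterpillar (Suc k)))"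
    by (auto simp: leaves_Node lessThan_Suc)
  moreover have "card ((#) 1 ` leaves (caterpillar (Suc k))) = Suc k"
    using 3 by (simp add: card_image num_leaves_def)
  moreover have "[0] \<notin> (#) 1 ` leaves (caterpillar (Suc k))"
    by auto
  ultimately show ?case
    by (simp add: num_leaves_def finite_leaves)
qed (simp_all add: num_leaves_def leaves_Node)

lemma dary_caterpillar: "d \<ge> 2 \<Longrightarrow> dary d (caterpillar k)"
  by (induction k rule: caterpillar.induct) (auto simp: dary_Node less_Suc_eq)

lemma inner_vertices_caterpillar:
  "vertices (caterpillar k) - leaves (caterpillar k) = (\<lambda>i. replicate i 1) ` {i. Suc i < k}"
proof (induction k rule: caterpillar.induct)
  case (3 k)
  have "vertices (caterpillar (Suc (Suc k))) - leaves (caterpillar (Suc (Suc k))) =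
        insert [] ((#) 1 ` (vertices (caterpillar (Suc k)) - leaves (caterpillar (Suc k))))"
    by (auto simp: vertices_Node leaves_Node lessThan_Suc)
  also have "\<dots> = insert [] ((\<lambda>i. replicate (Suc i) 1) ` {i. Suc i < Suc k})"
    by (simp add: 3 image_image)
  also have "\<dots> = (\<lambda>i. replicate i 1) ` insert 0 (Suc ` {i. Suc i < Suc k})"
    by (simp add: image_image)
  also have "insert 0 (Suc ` {i. Suc i < Suc k}) = {i. Suc i < Suc (Suc k)}"
    by (auto simp: image_iff gr0_conv_Suc less_Suc_eq_0_disj)
  finally show ?case .
qed (auto simp: vertices_Node leaves_Node)

text \<open>\<open>Min\<close> is applied to finite sets, nonempty for \<open>n \<ge> 1\<close>, so that it is the actual minimum.\<close>

lemma finite_copies: "finite {copies D T | T. dary d T \<and> num_leaves T = n}"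
proof (rule finite_subset)
  have "copies D T \<le> 2 ^ num_leaves T" for T
  proof -
    have "copies D T \<le> card (Pow (leaves T))"
      unfolding copies_def by (intro card_mono) (auto simp: finite_leaves)
    then show ?thesis
      by (simp add: card_Pow finite_leaves num_leaves_def)
  qed
  then show "{copies D T | T. dary d T \<and> num_leaves T = n} \<subseteq> {..2 ^ n}"
    by auto
qed simp

lemma copies_nonempty:
  "d \<ge> 2 \<Longrightarrow> n \<ge> 1 \<Longrightarrow> {copies D T | T. dary d T \<and> num_leaves T = n} \<noteq> {}"
  using dary_caterpillar num_leaves_caterpillar by blast

end

theory Submission
  imports Defs
begin

text \<open>
  Write \<open>c\<^sub>k(T)\<close> for the number of copies of the caterpillar with \<open>k\<close> leaves and let \<open>T\<close> have \<open>N\<close>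
  leaves and root branches \<open>T\<^sub>j\<close> with \<open>n\<^sub>j\<close> leaves. Then \<open>c\<^sub>2(T) = N choose 2\<close>, and for \<open>k \<ge> 3\<close> a
  copy either lies in one branch or consists of one leaf in some branch and a copy of the smaller
  caterpillar in another, so \<open>c\<^sub>k(T) = (\<Sum>j. c\<^sub>k(T\<^sub>j)) + (\<Sum>j. (N - n\<^sub>j) c\<^bsub>k-1\<^esub>(T\<^sub>j))\<close>. The claimed
  density \<open>a\<^sub>k\<close> satisfies \<open>a\<^bsub>k-1\<^esub> = a\<^sub>k (1 + d + \<dots> + d\<^sup>k\<^sup>-\<^sup>2)\<close>.

  Lower bound \<open>a\<^sub>k N\<^sup>k - N\<^sup>k\<^sup>-\<^sup>1 / 2\<close>: the induction over \<open>T\<close> reduces to the inequality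
  \<open>N\<^sup>k - (\<Sum>j. n\<^sub>j\<^sup>k) \<le> (1 + d + \<dots> + d\<^sup>k\<^sup>-\<^sup>2) q\<^bsub>k-1\<^esub>\<close> with \<open>q\<^sub>m = (\<Sum>j. n\<^sub>j\<^sup>m (N - n\<^sub>j))\<close>. The left-hand side
  telescopes into \<open>\<Sum>m. N\<^bsup>k-1-m\<^esup> q\<^sub>m\<close>, and \<open>N q\<^sub>m \<le> d q\<^bsub>m+1\<^esub>\<close> because there are at most \<open>d\<close> branches.

  Upper bound: trees that split the leaves as evenly as possible into \<open>d\<close> branches at every vertex.
\<close>

subsection \<open>An inequality for power sums\<close>

text \<open>This is the case \<open>m = 1\<close> of \<open>mixed_moment_growth\<close>, from which
  all larger exponents are deduced.\<close>

lemma sum_cubic_deviation_nonneg: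
  fixes x :: "'a \<Rightarrow> real"
  assumes fin: "finite I" and card: "card I \<le> d" and nonneg: "\<And>i. i \<in> I \<Longrightarrow> 0 \<le> x i"
    and N: "N = sum x I"
  shows "0 \<le> (\<Sum>i\<in>I. x i * (N - x i) * (real d * x i - N))"
proof -
  txt \<open>For \<open>d = card I\<close> the sum is half of \<open>\<Sum>i l. (x i - x l)\<^sup>2 * (N - x i - x l)\<close>.\<close>
  define p2 p3 c where "p2 = (\<Sum>i\<in>I. x i ^ 2)" and "p3 = (\<Sum>i\<in>I. x i ^ 3)" and "c = real (card I)"
  have inner: "(\<Sum>l\<in>I. (x i - x l)\<^sup>2 * (N - x i - x l)) =
      c * (N * x i ^ 2 - x i ^ 3) + N * p2 - 2 * N * N * x i - p3 + x i ^ 2 * N + x i * p2" for i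
  proof -
    have "(\<Sum>l\<in>I. (x i - x l)\<^sup>2 * (N - x i - x l)) =
       (\<Sum>l\<in>I. (N * x i ^ 2 - x i ^ 3) + N * x l ^ 2 - 2 * N * x i * x l - x l ^ 3
                + x i ^ 2 * x l + x i * x l ^ 2)"
      by (intro sum.cong refl) (simp add: power2_eq_square power3_eq_cube algebra_simps)
    also have "\<dots> = c * (N * x i ^ 2 - x i ^ 3) + N * p2 - 2 * N * x i * N - p3
                 + x i ^ 2 * N + x i * p2"
      by (simp add: sum.distrib sum_subtractf flip: sum_distrib_left p2_def p3_def c_def N)
    finally show ?thesis by (simp add: algebra_simps)
  qed
  have "(\<Sum>i\<in>I. \<Sum>l\<in>I. (x i - x l)\<^sup>2 * (N - x i - x l)) =
     c * (N * p2 - p3) + c * (N * p2) - 2 * N * N * N - c * p3 + p2 * N + N * p2"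
    unfolding inner
    by (simp add: sum.distrib sum_subtractf
        flip: sum_distrib_left sum_distrib_right p2_def p3_def c_def N)
  moreover have "0 \<le> (\<Sum>i\<in>I. \<Sum>l\<in>I. (x i - x l)\<^sup>2 * (N - x i - x l))"
  proof (intro sum_nonneg)
    fix i l assume il: "i \<in> I" "l \<in> I"
    show "0 \<le> (x i - x l)\<^sup>2 * (N - x i - x l)"
    proof (cases "i = l")
      case False
      have "sum x {i, l} \<le> N"
        unfolding N using il nonneg by (intro sum_mono2 fin) auto
      then show ?thesis using False by simp
    qed simp
  qed
  ultimately have "0 \<le> c * (N * p2) - N * N * N - c * p3 + N * p2"
    by (simp add: algebra_simps)
  \<comment> \<open>Passing from \<open>c = card I\<close> to the possibly larger \<open>d\<close>
    adds exactly \<open>(d - c) * (N * p2 - p3)\<close> to the sum. Both factors are nonnegative,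
    the second because no entry exceeds \<open>N\<close>.\<close>
  moreover have "0 \<le> (real d - c) * (N * p2 - p3)"
  proof -
    have "x i \<le> N" if "i \<in> I" for i
      unfolding N using that nonneg fin by (intro member_le_sum) auto
    then have "0 \<le> (\<Sum>i\<in>I. x i ^ 2 * (N - x i))"
      by (intro sum_nonneg) simp
    also have "\<dots> = N * p2 - p3"
      by (simp add: p2_def p3_def right_diff_distrib sum_subtractf sum_distrib_left
          power2_eq_square power3_eq_cube mult_ac)
    finally show ?thesis using card by (simp add: c_def)
  qed
  moreover have "(\<Sum>i\<in>I. x i * (N - x i) * (real d * x i - N)) =
      d * (N * p2) - N * N * N - d * p3 + N * p2"
  proof -
    have "(\<Sum>i\<in>I. x i * (N - x i) * (real d * x i - N)) =
      (\<Sum>i\<in>I. d * (N * x i ^ 2) - N * N * x i - d * x i ^ 3 + N * x i ^ 2)"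
      by (intro sum.cong refl) (simp add: power2_eq_square power3_eq_cube algebra_simps)
    then show ?thesis
      by (simp add: sum.distrib sum_subtractf flip: sum_distrib_left p2_def p3_def N)
  qed
  ultimately show ?thesis by (simp add: algebra_simps)
qed

text \<open>The right side minus the left is the sum from \<open>sum_cubic_deviation_nonneg\<close>
  with extra weights \<open>x i ^ (m - 1)\<close>. Freezing each weight at
  \<open>(N / d) ^ (m - 1)\<close> can only lower the sum, as in Chebyshev's inequality, and leaves
  a nonnegative multiple of the cubic sum.\<close>

lemma mixed_moment_growth:
  fixes x :: "'a \<Rightarrow> real"
  assumes fin: "finite I" and card: "card I \<le> d" and nonneg: "\<And>i. i \<in> I \<Longrightarrow> 0 \<le> x i"
    and N: "N = sum x I" and d: "d > 0" and m: "m > 0"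
  shows "N * (\<Sum>i\<in>I. x i ^ m * (N - x i)) \<le> d * (\<Sum>i\<in>I. x i ^ Suc m * (N - x i))"
proof -
  obtain j where j: "m = Suc j" using m gr0_conv_Suc by blast
  have le: "x i \<le> N" if "i \<in> I" for i
    unfolding N using that nonneg fin by (intro member_le_sum) auto
  have "0 \<le> (N / d) ^ j * (\<Sum>i\<in>I. x i * (N - x i) * (real d * x i - N))"
    using sum_cubic_deviation_nonneg[OF fin card nonneg N] nonneg
    by (intro mult_nonneg_nonneg zero_le_power) (auto simp: N sum_nonneg)
  also have "\<dots> = (\<Sum>i\<in>I. x i * (N - x i) * ((real d * x i - N) * (N / d) ^ j))"
    by (simp add: sum_distrib_left mult_ac)
  also have "\<dots> \<le> (\<Sum>i\<in>I. x i * (N - x i) * ((real d * x i - N) * x i ^ j))"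
  proof (rule sum_mono, rule mult_left_mono)
    fix i assume i: "i \<in> I"
    show "0 \<le> x i * (N - x i)" using le[OF i] nonneg[OF i] by simp
    have N0: "0 \<le> N / d" using le[OF i] nonneg[OF i] by simp
    txt \<open>\<open>d * x i - N\<close> and \<open>x i ^ j - (N / d) ^ j\<close> have the same sign.\<close>
    show "(real d * x i - N) * (N / d) ^ j \<le> (real d * x i - N) * x i ^ j"
    proof (cases "N / d \<le> x i")
      case True
      then have "0 \<le> real d * x i - N" using d by (simp add: field_simps)
      then show ?thesis using power_mono[OF True N0] by (intro mult_left_mono) auto
    next
      case False
      then have "real d * x i - N \<le> 0" using d by (simp add: field_simps)
      moreover have "x i ^ j \<le> (N / d) ^ j" using False nonneg[OF i] by (intro power_mono) auto
      ultimately show ?thesis by (intro mult_left_mono_neg)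
    qed
  qed
  also have "\<dots> = d * (\<Sum>i\<in>I. x i ^ Suc m * (N - x i)) - N * (\<Sum>i\<in>I. x i ^ m * (N - x i))"
    by (simp add: sum_distrib_left sum_subtractf[symmetric] j algebra_simps)
  finally show ?thesis by simp
qed

text \<open>Each induction step multiplies the old defect by \<open>N\<close> and adds the next
  mixed moment. After \<open>mixed_moment_growth\<close> the factors obey
  \<open>G (m + 1) = 1 + d * G m\<close>, the recursion of the geometric sum. Equality holds for
  \<open>d\<close> equal entries, which is why even splitting is asymptotically optimal.\<close>

lemma power_sum_defect_le:
  fixes x :: "'a \<Rightarrow> real"
  assumes fin: "finite I" and card: "card I \<le> d" and nonneg: "\<And>i. i \<in> I \<Longrightarrow> 0 \<le> x i"
    and N: "N = sum x I" and d: "d > 0" and "m > 0"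
  shows "N ^ Suc m - (\<Sum>i\<in>I. x i ^ Suc m)
    \<le> (\<Sum>i<m. real d ^ i) * (\<Sum>i\<in>I. x i ^ m * (N - x i))"
  using \<open>m > 0\<close>
proof (induction m rule: nat_induct_non_zero)
  case 1
  have "N ^ Suc 1 - (\<Sum>i\<in>I. x i ^ Suc 1) = (\<Sum>i\<in>I. x i ^ 1 * (N - x i))"
    by (simp add: right_diff_distrib sum_subtractf flip: sum_distrib_right N)
  then show ?case by simp
next
  case (Suc m)
  define q where "q = (\<lambda>m. \<Sum>i\<in>I. x i ^ m * (N - x i))"
  have "N ^ Suc (Suc m) - (\<Sum>i\<in>I. x i ^ Suc (Suc m)) =
      N * (N ^ Suc m - (\<Sum>i\<in>I. x i ^ Suc m)) + q (Suc m)"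
    by (simp add: q_def algebra_simps sum_subtractf sum_distrib_left)
  also have "\<dots> \<le> N * ((\<Sum>i<m. real d ^ i) * q m) + q (Suc m)"
    using Suc.IH nonneg unfolding q_def
    by (intro add_right_mono mult_left_mono) (auto simp: N sum_nonneg)
  also have "\<dots> = (\<Sum>i<m. real d ^ i) * (N * q m) + q (Suc m)"
    by simp
  also have "\<dots> \<le> (\<Sum>i<m. real d ^ i) * (d * q (Suc m)) + q (Suc m)"
    using mixed_moment_growth[OF fin card nonneg N d \<open>m > 0\<close>] unfolding q_def
    by (intro add_right_mono mult_left_mono) (auto intro: sum_nonneg)
  also have "\<dots> = (\<Sum>i<Suc m. real d ^ i) * q (Suc m)"
    unfolding sum.lessThan_Suc_shift by (simp add: sum_distrib_left sum_distrib_right algebra_simps)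
  finally show ?case by (simp add: q_def)
qed

subsection \<open>The asymptotic density\<close>

text \<open>The leading coefficient of the theorem, with each factor
  \<open>(d - 1) / (d ^ j - 1)\<close> written as the inverse of a geometric sum. This is the form
  in which the factors arise from \<open>power_sum_defect_le\<close>.\<close>

definition cat_density :: "nat \<Rightarrow> nat \<Rightarrow> real" where
  "cat_density d k = (\<Prod>j = 1..k - 1. inverse (\<Sum>i<j. real d ^ i)) / 2"

lemma cat_density_2 [simp]: "cat_density d 2 = 1 / 2"
  by (simp add: cat_density_def)

lemma cat_density_nonneg [simp]: "0 \<le> cat_density d k"
  by (simp add: cat_density_def prod_nonneg sum_nonneg)

lemma geometric_sum_pos: "d > 0 \<Longrightarrow> m > 0 \<Longrightarrow> 0 < (\<Sum>i<m. real d ^ i)"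
  by (intro sum_pos) auto

lemma cat_density_Suc:
  assumes "d > 0" "k > 0"
  shows "cat_density d (Suc k) * (\<Sum>i<k. real d ^ i) = cat_density d k"
proof -
  have "{1..Suc k - 1} = insert k {1..k - 1}" using assms by auto
  then have "cat_density d (Suc k) = inverse (\<Sum>i<k. real d ^ i) * cat_density d k"
    using assms(2) by (simp add: cat_density_def)
  then show ?thesis using geometric_sum_pos[OF assms] by simp
qed

text \<open>Needed for the single-leaf tree in the lower bound, where there are no copies and the
  claim becomes \<open>cat_density d k - 1 / 2 \<le> 0\<close>.\<close>

lemma cat_density_le: "d > 0 \<Longrightarrow> cat_density d k \<le> 1 / 2"
proof -
  assume d: "d > 0"
  have "(\<Prod>j = 1..k - 1. inverse (\<Sum>i<j. real d ^ i)) \<le> 1"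
  proof (intro prod_le_1 conjI)
    fix j assume "j \<in> {1..k - 1}"
    then obtain j' where "j = Suc j'" by (cases j) auto
    then have "(1::real) \<le> (\<Sum>i<j. real d ^ i)"
      unfolding \<open>j = Suc j'\<close> sum.lessThan_Suc_shift by (simp add: sum_nonneg)
    then show "inverse (\<Sum>i<j. real d ^ i) \<le> 1" by (simp add: inverse_le_1_iff)
  qed (simp add: sum_nonneg)
  then show ?thesis by (simp add: cat_density_def)
qed

lemma cat_density_eq:
  assumes "d \<ge> 2"
  shows "cat_density d k = (real d - 1) ^ (k - 1) * inverse (\<Prod>j = 1..k - 1. (real d ^ j - 1)) / 2"
proof -
  have "inverse (\<Sum>i<j. real d ^ i) = (real d - 1) * inverse (real d ^ j - 1)" for j
    using assms by (simp add: geometric_sum field_simps)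
  then show ?thesis
    by (simp add: cat_density_def prod.distrib prod_inversef[symmetric])
qed

subsection \<open>Isomorphism of trees\<close>

lemma is_child_simps [simp]:
  "is_child (i # q) (j # p) \<longleftrightarrow> i = j \<and> is_child q p"
  "\<not> is_child [] p"
  "is_child q [] \<longleftrightarrow> (\<exists>i. q = [i])"
  by (auto simp: is_child_def)

lemma Nil_in_vertices [simp]: "[] \<in> vertices t"
  by (simp add: vertices_def)

lemma Cons_in_vertices [simp]:
  "i # p \<in> vertices (Node ts) \<longleftrightarrow> i < length ts \<and> p \<in> vertices (ts ! i)"
  by (simp add: vertices_def)

lemma vertices_appendD: "p @ q \<in> vertices t \<Longrightarrow> p \<in> vertices t"
proof (induction p arbitrary: t)
  case (Cons i p)
  then show ?case by (cases t) auto
qed simp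

text \<open>A root-preserving map that respects the child relation permutes the children of the
  root. It carries the branch at \<open>i\<close> onto the branch at \<open>\<pi> i\<close>, so
  stripping the first index yields isomorphisms of the branches.\<close>

lemma isomorphic_NodeD:
  assumes "isomorphic (Node ts) (Node us)"
  obtains \<pi> where "bij_betw \<pi> {..<length ts} {..<length us}"
    and "\<And>i. i < length ts \<Longrightarrow> isomorphic (ts ! i) (us ! \<pi> i)"
proof -
  obtain f where bij: "bij_betw f (vertices (Node ts)) (vertices (Node us))" and root: "f [] = []"
    and child: "\<And>p q. p \<in> vertices (Node ts) \<Longrightarrow> q \<in> vertices (Node ts) \<Longrightarrow>
      is_child q p \<longleftrightarrow> is_child (f q) (f p)"
    using assms unfolding isomorphic_def by blast
  have f_in: "f p \<in> vertices (Node us)" if "p \<in> vertices (Node ts)" for p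
    using bij that by (auto simp: bij_betw_def)
  have f_inj: "p = q" if "f p = f q" "p \<in> vertices (Node ts)" "q \<in> vertices (Node ts)" for p q
    using bij that by (auto simp: bij_betw_def inj_on_def)
  have f_surj: "\<exists>p \<in> vertices (Node ts). f p = q" if "q \<in> vertices (Node us)" for q
    using that by (metis bij bij_betw_imp_surj_on imageE)
  define \<pi> where "\<pi> = (\<lambda>i. hd (f [i]))"
  have f_single: "f [i] = [\<pi> i]" if "i < length ts" for i
    using child[of "[]" "[i]"] that root by (auto simp: \<pi>_def)
  have \<pi>_less: "\<pi> i < length us" if "i < length ts" for i
    using f_in[of "[i]"] f_single[OF that] that by simp
  \<comment> \<open>The address is extended at its end: the image of a child is a child of the
    image, so it keeps the first index \<open>\<pi> i\<close>.\<close>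
  have f_Cons: "\<exists>q. f (i # p) = \<pi> i # q \<and> q \<in> vertices (us ! \<pi> i)"
    if "i < length ts" "p \<in> vertices (ts ! i)" for i p
    using that(2)
  proof (induction p rule: rev_induct)
    case Nil
    then show ?case using f_single[OF that(1)] by simp
  next
    case (snoc j p)
    then have p: "p \<in> vertices (ts ! i)" using vertices_appendD by blast
    then obtain q where q: "f (i # p) = \<pi> i # q" using snoc.IH by blast
    have "is_child (i # p @ [j]) (i # p)" by (simp add: is_child_def)
    then have "is_child (f (i # p @ [j])) (\<pi> i # q)"
      using child[of "i # p" "i # p @ [j]"] p snoc.prems that(1) q by simp
    then obtain l where "f (i # p @ [j]) = \<pi> i # q @ [l]" by (auto simp: is_child_def)
    then show ?case using f_in[of "i # p @ [j]"] snoc.prems that(1) by simp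
  qed
  define g where "g = (\<lambda>i p. tl (f (i # p)))"
  have f_eq: "f (i # p) = \<pi> i # g i p" and g_in: "g i p \<in> vertices (us ! \<pi> i)"
    if "i < length ts" "p \<in> vertices (ts ! i)" for i p
    using f_Cons[OF that] by (auto simp: g_def)
  have f_inv: "\<exists>i p. i < length ts \<and> p \<in> vertices (ts ! i) \<and> \<pi> i = j \<and> g i p = q"
    if "j < length us" "q \<in> vertices (us ! j)" for j q
  proof -
    have "j # q \<in> vertices (Node us)" using that by simp
    then obtain r where r: "r \<in> vertices (Node ts)" "f r = j # q"
      using f_surj by blast
    then obtain i p where "r = i # p" using root by (cases r) auto
    then show ?thesis using r f_eq by fastforce
  qed
  have \<pi>_inj: "inj_on \<pi> {..<length ts}"
    using f_single f_inj by (intro inj_onI) (metis Cons_in_vertices Nil_in_vertices lessThan_iff list.inject)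
  have "bij_betw \<pi> {..<length ts} {..<length us}"
    unfolding bij_betw_def
  proof (intro conjI \<pi>_inj equalityI subsetI)
    fix j assume "j \<in> {..<length us}"
    then show "j \<in> \<pi> ` {..<length ts}" using f_inv[of j "[]"] by auto
  qed (use \<pi>_less in auto)
  moreover have "isomorphic (ts ! i) (us ! \<pi> i)" if i: "i < length ts" for i
    unfolding isomorphic_def
  proof (intro exI[of _ "g i"] conjI ballI)
    show "bij_betw (g i) (vertices (ts ! i)) (vertices (us ! \<pi> i))"
      unfolding bij_betw_def
    proof (intro conjI equalityI subsetI inj_onI)
      fix p q assume "p \<in> vertices (ts ! i)" "q \<in> vertices (ts ! i)" "g i p = g i q"
      then show "p = q" using f_inj[of "i # p" "i # q"] f_eq i by simp
    next
      fix q assume "q \<in> vertices (us ! \<pi> i)"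
      then obtain i' p where "i' < length ts" "p \<in> vertices (ts ! i')" "\<pi> i' = \<pi> i" "g i' p = q"
        using f_inv[of "\<pi> i" q] \<pi>_less[OF i] by blast
      then show "q \<in> g i ` vertices (ts ! i)"
        using \<pi>_inj i by (metis image_eqI inj_onD lessThan_iff)
    qed (use g_in i in auto)
    show "g i [] = []" using f_eq[OF i, of "[]"] f_single[OF i] by simp
    fix p q assume "p \<in> vertices (ts ! i)" "q \<in> vertices (ts ! i)"
    then show "is_child q p \<longleftrightarrow> is_child (g i q) (g i p)"
      using child[of "i # p" "i # q"] f_eq i by simp
  qed
  ultimately show thesis by (rule that)
qed

lemma isomorphic_NodeI:
  assumes bij: "bij_betw \<pi> {..<length ts} {..<length us}"
    and iso: "\<And>i. i < length ts \<Longrightarrow> isomorphic (ts ! i) (us ! \<pi> i)"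
  shows "isomorphic (Node ts) (Node us)"
proof -
  have "\<forall>i. \<exists>g. i < length ts \<longrightarrow> bij_betw g (vertices (ts ! i)) (vertices (us ! \<pi> i)) \<and> g [] = [] \<and>
     (\<forall>p \<in> vertices (ts ! i). \<forall>q \<in> vertices (ts ! i). is_child q p \<longleftrightarrow> is_child (g q) (g p))"
    using iso unfolding isomorphic_def by blast
  then obtain g where g: "\<And>i. i < length ts \<Longrightarrow>
      bij_betw (g i) (vertices (ts ! i)) (vertices (us ! \<pi> i))"
    and g_Nil: "\<And>i. i < length ts \<Longrightarrow> g i [] = []"
    and g_child: "\<And>i p q. i < length ts \<Longrightarrow> p \<in> vertices (ts ! i) \<Longrightarrow> q \<in> vertices (ts ! i) \<Longrightarrow>
      is_child q p \<longleftrightarrow> is_child (g i q) (g i p)"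
    by metis
  have g_in: "g i p \<in> vertices (us ! \<pi> i)" if "i < length ts" "p \<in> vertices (ts ! i)" for i p
    using g that by (auto simp: bij_betw_def)
  have \<pi>_less: "\<pi> i < length us" if "i < length ts" for i
    using bij that by (auto simp: bij_betw_def)
  have \<pi>_eq: "\<pi> i = \<pi> j \<longleftrightarrow> i = j" if "i < length ts" "j < length ts" for i j
    using bij that by (auto simp: bij_betw_def inj_on_def)
  define f where "f = (\<lambda>p. case p of [] \<Rightarrow> [] | i # p \<Rightarrow> \<pi> i # g i p)"
  have f_simps [simp]: "f [] = []" "f (i # p) = \<pi> i # g i p" for i p
    by (simp_all add: f_def)
  have g_eq: "g i p = [] \<longleftrightarrow> p = []" if "i < length ts" "p \<in> vertices (ts ! i)" for i p
    using g[OF that(1)] g_Nil[OF that(1)] that(2)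
    by (metis Nil_in_vertices bij_betw_imp_inj_on inj_onD)
  have inj: "p = q" if "p \<in> vertices (Node ts)" "q \<in> vertices (Node ts)" "f p = f q" for p q
  proof (cases p; cases q)
    fix i p' j q' assume "p = i # p'" "q = j # q'"
    then show ?thesis using that \<pi>_eq[of i j] g[of i] by (auto simp: bij_betw_def inj_on_def)
  qed (use that in auto)
  have "bij_betw f (vertices (Node ts)) (vertices (Node us))"
    unfolding bij_betw_def
  proof (intro conjI equalityI subsetI inj_onI)
    fix q assume q: "q \<in> vertices (Node us)"
    show "q \<in> f ` vertices (Node ts)"
    proof (cases q)
      case Nil
      then show ?thesis by (metis Nil_in_vertices f_simps(1) image_eqI)
    next
      case (Cons j q')
      then have "j \<in> \<pi> ` {..<length ts}"
        using q bij_betw_imp_surj_on[OF bij] by simp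
      then obtain i where i: "i < length ts" "\<pi> i = j" by auto
      have "q' \<in> g i ` vertices (ts ! i)"
        using q Cons i bij_betw_imp_surj_on[OF g[OF i(1)]] by simp
      then obtain p where "p \<in> vertices (ts ! i)" "g i p = q'" by auto
      then show ?thesis using i Cons by (metis Cons_in_vertices f_simps(2) image_eqI)
    qed
  next
    fix p assume "p \<in> f ` vertices (Node ts)"
    then obtain q where "q \<in> vertices (Node ts)" "p = f q" by blast
    then show "p \<in> vertices (Node us)" using \<pi>_less g_in by (cases q) auto
  qed (use inj in auto)
  moreover have "is_child q p \<longleftrightarrow> is_child (f q) (f p)"
    if "p \<in> vertices (Node ts)" "q \<in> vertices (Node ts)" for p q
  proof (cases p; cases q)
    fix i p' j q' assume "p = i # p'" "q = j # q'"
    then show ?thesis using that \<pi>_eq[of i j] g_child[of i p' q'] by auto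
  qed (use that g_eq in auto)
  ultimately show ?thesis unfolding isomorphic_def by (auto intro!: exI[of _ f])
qed

text \<open>Isomorphism is thereby recursive: a matching of the root branches. Later arguments work
  with the branches and no longer with vertex maps.\<close>

lemma isomorphic_Node_iff:
  "isomorphic (Node ts) (Node us) \<longleftrightarrow> (\<exists>\<pi>. bij_betw \<pi> {..<length ts} {..<length us} \<and>
     (\<forall>i<length ts. isomorphic (ts ! i) (us ! \<pi> i)))"
  by (meson isomorphic_NodeD isomorphic_NodeI)

lemma isomorphic_length: "isomorphic (Node ts) (Node us) \<Longrightarrow> length ts = length us"
  by (metis isomorphic_NodeD bij_betw_same_card card_lessThan)

lemma isomorphic_leaf_iff [simp]: "isomorphic (Node ts) (Node []) \<longleftrightarrow> ts = []"
  using isomorphic_length[of ts "[]"] by (auto simp: isomorphic_Node_iff bij_betw_def)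

lemma isomorphic_binary_iff:
  "isomorphic (Node [t, u]) (Node [v, w]) \<longleftrightarrow>
     isomorphic t v \<and> isomorphic u w \<or> isomorphic t w \<and> isomorphic u v" (is "?l \<longleftrightarrow> ?r")
proof
  assume ?l
  then obtain \<pi> where \<pi>: "bij_betw \<pi> {..<2} {..<2::nat}"
    and iso: "\<And>i. i < 2 \<Longrightarrow> isomorphic ([t, u] ! i) ([v, w] ! \<pi> i)"
    by (auto elim!: isomorphic_NodeD simp: eval_nat_numeral)
  have "\<pi> 0 \<in> {..<2}" "\<pi> 1 \<in> {..<2}" "\<pi> 0 \<noteq> \<pi> 1"
    using bij_betwE[OF \<pi>] inj_on_eq_iff[OF bij_betw_imp_inj_on[OF \<pi>], of 0 1] by auto
  then have "\<pi> 0 = 0 \<and> \<pi> 1 = 1 \<or> \<pi> 0 = 1 \<and> \<pi> 1 = 0"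
    by (auto simp: less_2_cases_iff)
  then show ?r using iso[of 0] iso[of 1] by auto
next
  assume ?r
  then show ?l
  proof
    assume "isomorphic t v \<and> isomorphic u w"
    then show ?l
      by (intro isomorphic_NodeI[of id]) (auto simp: less_Suc_eq)
  next
    assume "isomorphic t w \<and> isomorphic u v"
    then show ?l
      by (intro isomorphic_NodeI[of "\<lambda>i. 1 - i"])
        (auto simp: less_Suc_eq bij_betw_def inj_on_def lessThan_Suc)
  qed
qed

subsection \<open>Counting copies of caterpillars recursively\<close>

lemma isomorphic_binary_length:
  "isomorphic (Node ts) (Node [v, w]) \<Longrightarrow> length ts = 2"
  using isomorphic_length by fastforce

section \<open>Induced trees computed branch by branch\<close>

definition slice :: "nat \<Rightarrow> nat list set \<Rightarrow> nat list set" where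
  "slice i L = {p. i # p \<in> L}"

lemma slice_simps [simp]:
  "slice i ((#) j ` A) = (if i = j then A else {})"
  "slice i (A \<union> B) = slice i A \<union> slice i B"
  "slice i (insert (j # p) A) = (if i = j then insert p (slice i A) else slice i A)"
  "slice i {} = {}"
  by (auto simp: slice_def)

lemma prune_Node:
  "prune (Node ts) L =
     Node (map (\<lambda>i. prune (ts ! i) (slice i L)) (filter (\<lambda>i. slice i L \<noteq> {}) [0..<length ts]))"
  by (simp add: slice_def)

declare prune.simps [simp del]

lemma prune_leaf [simp]: "prune (Node []) L = Node []"
  by (simp add: prune_Node)

lemma suppress_many: "length ts \<ge> 2 \<Longrightarrow> suppress (Node ts) = Node (map suppress ts)"
  by (cases "Node ts" rule: suppress.cases) auto

lemma leaves_leaf [simp]: "leaves (Node []) = {[]}"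
  by (simp add: leaves_Node)

lemma Cons_in_leaves [simp]: "i # p \<in> leaves (Node ts) \<longleftrightarrow> i < length ts \<and> p \<in> leaves (ts ! i)"
  by (auto simp: leaves_Node)

lemma Nil_in_leaves [simp]: "[] \<in> leaves (Node ts) \<longleftrightarrow> ts = []"
  by (auto simp: leaves_Node)

lemma slice_leaves: "L \<subseteq> leaves (Node ts) \<Longrightarrow> slice i L \<subseteq> leaves (ts ! i)"
  by (auto simp: slice_def)

text \<open>If \<open>L\<close> meets only one branch, the root has outdegree 1 after pruning and is
  suppressed. Otherwise it survives, with one child for every branch that \<open>L\<close> meets;
  \<open>bs\<close> lists these branches in order.\<close>

lemma induced_cases:
  assumes L: "L \<subseteq> leaves (Node ts)" "L \<noteq> {}" and ts: "ts \<noteq> []"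
  obtains (one) i where "i < length ts" "slice i L \<noteq> {}" "(#) i ` slice i L = L"
      "suppress (prune (Node ts) L) = suppress (prune (ts ! i) (slice i L))"
  | (many) bs where "distinct bs" "length bs \<ge> 2" "set bs = {i. i < length ts \<and> slice i L \<noteq> {}}"
      "(\<Union>i\<in>set bs. (#) i ` slice i L) = L"
      "suppress (prune (Node ts) L) = Node (map (\<lambda>i. suppress (prune (ts ! i) (slice i L))) bs)"
proof -
  define bs where "bs = filter (\<lambda>i. slice i L \<noteq> {}) [0..<length ts]"
  have set_bs: "set bs = {i. i < length ts \<and> slice i L \<noteq> {}}" by (auto simp: bs_def)
  have L_eq: "(\<Union>i\<in>set bs. (#) i ` slice i L) = L"
  proof (intro equalityI subsetI)
    fix p assume p: "p \<in> L"
    then obtain i q where iq: "p = i # q" using L ts by (cases p) auto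
    then have "i < length ts" "q \<in> slice i L" using p L by (auto simp: slice_def)
    then show "p \<in> (\<Union>i\<in>set bs. (#) i ` slice i L)"
      using iq by (auto simp: set_bs)
  qed (auto simp: slice_def)
  have prune_eq: "prune (Node ts) L = Node (map (\<lambda>i. prune (ts ! i) (slice i L)) bs)"
    by (simp add: prune_Node bs_def)
  have "bs \<noteq> []" using L L_eq by auto
  \<comment> \<open>The rule \<open>remdups_adj.cases\<close> serves only to split a list by length:
    empty, one entry, or at least two.\<close>
  then consider i where "bs = [i]" | "length bs \<ge> 2"
    by (cases bs rule: remdups_adj.cases) auto
  then show thesis
  proof cases
    case 1
    show thesis
    proof (rule one)
      show "i < length ts" "slice i L \<noteq> {}" using 1 set_bs by auto
      show "(#) i ` slice i L = L" using 1 L_eq by simp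
      show "suppress (prune (Node ts) L) = suppress (prune (ts ! i) (slice i L))"
        using 1 prune_eq by simp
    qed
  next
    case 2
    show thesis
    proof (rule many[OF _ 2 set_bs L_eq])
      show "distinct bs" by (simp add: bs_def)
      show "suppress (prune (Node ts) L) = Node (map (\<lambda>i. suppress (prune (ts ! i) (slice i L))) bs)"
        using 2 by (simp add: prune_eq suppress_many comp_def)
    qed
  qed
qed

text \<open>All proper ancestors of the lowest common ancestor of \<open>L\<close> have outdegree 1
  after pruning, so \<open>suppress\<close> erases them. Pruning from the root of \<open>t\<close>
  thus gives the same tree and allows recursion over the branches.\<close>

lemma induced_eq_suppress_prune:
  "L \<subseteq> leaves t \<Longrightarrow> L \<noteq> {} \<Longrightarrow> induced t L = suppress (prune t L)"
proof (induction t arbitrary: L)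
  case (Node ts)
  show ?case
  proof (cases "ts = []")
    case True
    then have "L = {[]}" using Node.prems by auto
    then show ?thesis
      using True by (simp add: induced_def minimal_subtree_def Longest_common_prefix_Nil)
  next
    case False
    with Node.prems show ?thesis
    proof (cases rule: induced_cases)
      case (one i)
      have "Longest_common_prefix L = i # Longest_common_prefix (slice i L)"
        using one Longest_common_prefix_image_Cons by metis
      moreover have "{p. i # r @ p \<in> L} = {p. r @ p \<in> slice i L}" for r
        by (simp add: slice_def)
      ultimately have "induced (Node ts) L = induced (ts ! i) (slice i L)"
        by (simp add: induced_def minimal_subtree_def Let_def)
      also have "\<dots> = suppress (prune (ts ! i) (slice i L))"
        using one Node.prems by (intro Node.IH slice_leaves) auto
      finally show ?thesis using one by simp
    next
      case (many bs)
      then obtain i j where "i \<in> set bs" "j \<in> set bs" "i \<noteq> j"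
        by (cases bs rule: remdups_adj.cases) auto
      moreover from this obtain p q where "i # p \<in> L" "j # q \<in> L"
        using many(3) by (auto simp: slice_def)
      ultimately have "Longest_common_prefix L = []"
        using Longest_common_prefix_eq_Nil by metis
      then show ?thesis by (simp add: induced_def minimal_subtree_def Let_def)
    qed
  qed
qed

lemma card_eq_1_if_suppress_prune_leaf:
  "L \<subseteq> leaves t \<Longrightarrow> L \<noteq> {} \<Longrightarrow> suppress (prune t L) = Node [] \<Longrightarrow> card L = 1"
proof (induction t arbitrary: L)
  case (Node ts)
  show ?case
  proof (cases "ts = []")
    case True
    then have "L = {[]}" using Node.prems by auto
    then show ?thesis by simp
  next
    case False
    with Node.prems(1,2) show ?thesis
    proof (cases rule: induced_cases)
      case (one i)
      have "card (slice i L) = 1"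
        using one Node.prems by (intro Node.IH[of "ts ! i"] slice_leaves) auto
      then show ?thesis using one(3) by (metis card_image inj_on_Cons1)
    qed (use Node.prems in auto)
  qed
qed

lemma suppress_prune_singleton: "p \<in> leaves t \<Longrightarrow> suppress (prune t {p}) = Node []"
proof (induction t arbitrary: p)
  case (Node ts)
  show ?case
  proof (cases "ts = []")
    case False
    with Node.prems obtain i q where p: "p = i # q" by (cases p) auto
    have "{p} \<subseteq> leaves (Node ts)" "{p} \<noteq> {}" using Node.prems by auto
    from this False show ?thesis
    proof (cases rule: induced_cases)
      case (one i')
      then show ?thesis using Node.prems Node.IH[of "ts ! i" q] p by (auto split: if_splits)
    next
      case (many bs)
      have "card (set bs) \<ge> 2" using many(1,2) by (simp add: distinct_card)
      moreover have "set bs \<subseteq> {i}" using many(3) p by (auto split: if_splits)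
      then have "card (set bs) \<le> 1" using card_mono[of "{i}"] by fastforce
      ultimately show ?thesis by simp
    qed
  qed simp
qed

lemma suppress_prune_leaf_iff:
  assumes "L \<subseteq> leaves t" "L \<noteq> {}"
  shows "suppress (prune t L) = Node [] \<longleftrightarrow> card L = 1"
  using assms card_eq_1_if_suppress_prune_leaf suppress_prune_singleton
  by (metis card_1_singletonE insert_subset)

section \<open>Leaf sets that induce caterpillars\<close>

text \<open>
  \<open>cat_sets\<close> omits the cardinality condition of \<open>copies\<close>: it is automatic for nonempty sets of
  leaves (\<open>card_cat_sets\<close> below), which keeps the recursion over the children simple.
\<close>

definition cat_sets :: "nat \<Rightarrow> rtree \<Rightarrow> nat list set set" where
  "cat_sets k t =
     {L. L \<subseteq> leaves t \<and> L \<noteq> {} \<and> isomorphic (suppress (prune t L)) (caterpillar k)}"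

lemma finite_cat_sets [simp]: "finite (cat_sets k t)"
  by (rule finite_subset[of _ "Pow (leaves t)"]) (auto simp: cat_sets_def finite_leaves)

lemma isomorphic_leaf_iff': "isomorphic t (Node []) \<longleftrightarrow> t = Node []"
  by (cases t) simp

lemma cat_sets_1: "cat_sets (Suc 0) t = {L. L \<subseteq> leaves t \<and> card L = 1}"
proof (intro set_eqI)
  fix L
  have "L \<in> cat_sets (Suc 0) t \<longleftrightarrow> L \<subseteq> leaves t \<and> L \<noteq> {} \<and> card L = 1"
    using suppress_prune_leaf_iff[of L t] by (auto simp: cat_sets_def isomorphic_leaf_iff')
  then show "L \<in> cat_sets (Suc 0) t \<longleftrightarrow> L \<in> {L. L \<subseteq> leaves t \<and> card L = 1}"
    by auto
qed

lemma singleton_in_cat_sets [simp]: "{p} \<in> cat_sets (Suc 0) t \<longleftrightarrow> p \<in> leaves t"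
  by (simp add: cat_sets_1)

lemma cat_sets_leaf [simp]: "cat_sets (Suc (Suc k)) (Node []) = {}"
  by (auto simp: cat_sets_def dest: isomorphic_length)

lemma cat_sets_Node_cases:
  assumes L: "L \<in> cat_sets (Suc (Suc k)) (Node ts)"
  obtains (one) i A where "i < length ts" "A \<in> cat_sets (Suc (Suc k)) (ts ! i)" "L = (#) i ` A"
  | (two) i j p B where "i < length ts" "j < length ts" "i \<noteq> j" "p \<in> leaves (ts ! i)"
      "B \<in> cat_sets (Suc k) (ts ! j)" "L = insert (i # p) ((#) j ` B)"
proof -
  note two_case = that(2)
  have L': "L \<subseteq> leaves (Node ts)" "L \<noteq> {}"
    and iso: "isomorphic (suppress (prune (Node ts) L)) (caterpillar (Suc (Suc k)))"
    using L by (auto simp: cat_sets_def)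
  have "ts \<noteq> []" using L by auto
  with L' show thesis
  proof (cases rule: induced_cases)
    case (one i)
    then show thesis
      using that(1)[of i "slice i L"] iso slice_leaves[OF L'(1)] by (auto simp: cat_sets_def)
  next
    case (many bs)
    have "length bs = 2" using iso many(5) isomorphic_binary_length
      by (metis caterpillar.simps(3) length_map)
    then obtain a b where bs: "bs = [a, b]"
      by (cases bs rule: remdups_adj.cases) auto
    have L_eq: "(#) a ` slice a L \<union> (#) b ` slice b L = L" using many(4) bs by simp
    have ab: "a < length ts" "b < length ts" "a \<noteq> b" "slice a L \<noteq> {}" "slice b L \<noteq> {}"
      using many(1,3) bs by auto
    \<comment> \<open>Either of the two branches met by \<open>L\<close> may supply the single leaf.
      The argument is therefore stated for a pair \<open>i\<close>, \<open>j\<close> with the leaf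
      in branch \<open>i\<close> and applied to both orders of \<open>a\<close> and
      \<open>b\<close>.\<close>
    have two': thesis
      if "i < length ts" "j < length ts" "i \<noteq> j" "slice i L \<noteq> {}" "slice j L \<noteq> {}"
        "(#) i ` slice i L \<union> (#) j ` slice j L = L"
        "isomorphic (suppress (prune (ts ! i) (slice i L))) (Node [])"
        "isomorphic (suppress (prune (ts ! j) (slice j L))) (caterpillar (Suc k))" for i j
    proof -
      have "card (slice i L) = 1"
        using that slice_leaves[OF L'(1)] by (simp add: isomorphic_leaf_iff' suppress_prune_leaf_iff)
      then obtain p where p: "slice i L = {p}" by (rule card_1_singletonE)
      show thesis
      proof (rule two_case)
        show "i < length ts" "j < length ts" "i \<noteq> j" by fact+
        show "p \<in> leaves (ts ! i)" using slice_leaves[OF L'(1), of i] p by auto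
        show "slice j L \<in> cat_sets (Suc k) (ts ! j)"
          using that slice_leaves[OF L'(1)] by (simp add: cat_sets_def)
        show "L = insert (i # p) ((#) j ` slice j L)" using that(6) p by simp
      qed
    qed
    have "isomorphic (suppress (prune (ts ! a) (slice a L))) (Node []) \<and>
          isomorphic (suppress (prune (ts ! b) (slice b L))) (caterpillar (Suc k)) \<or>
        isomorphic (suppress (prune (ts ! b) (slice b L))) (Node []) \<and>
          isomorphic (suppress (prune (ts ! a) (slice a L))) (caterpillar (Suc k))"
      using iso unfolding many(5) bs by (auto simp: isomorphic_binary_iff)
    moreover have "(#) b ` slice b L \<union> (#) a ` slice a L = L" using L_eq by blast
    ultimately show thesis
      using two'[OF ab(1,2,3,4,5) L_eq] two'[OF ab(2,1) ab(3)[symmetric] ab(5,4)] by blast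
  qed
qed

lemma cat_sets_Node_oneI:
  assumes i: "i < length ts" and A: "A \<in> cat_sets k (ts ! i)"
  shows "(#) i ` A \<in> cat_sets k (Node ts)"
proof -
  have L: "(#) i ` A \<subseteq> leaves (Node ts)" "(#) i ` A \<noteq> {}" "ts \<noteq> []"
    using assms by (auto simp: cat_sets_def)
  then show ?thesis
  proof (cases rule: induced_cases)
    case (one i')
    then show ?thesis using L A by (auto simp: cat_sets_def split: if_splits)
  next
    case (many bs)
    have "set bs \<subseteq> {i}" using many(3) by (auto split: if_splits)
    then have "card (set bs) \<le> 1" using card_mono[of "{i}"] by fastforce
    then show ?thesis using many(1,2) by (simp add: distinct_card)
  qed
qed

lemma cat_sets_Node_twoI:
  assumes ij: "i < length ts" "j < length ts" "i \<noteq> j" and p: "p \<in> leaves (ts ! i)"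
    and B: "B \<in> cat_sets (Suc k) (ts ! j)"
  shows "insert (i # p) ((#) j ` B) \<in> cat_sets (Suc (Suc k)) (Node ts)" (is "?L \<in> _")
proof -
  have "B \<noteq> {}" using B by (simp add: cat_sets_def)
  have L: "?L \<subseteq> leaves (Node ts)" "?L \<noteq> {}" "ts \<noteq> []"
    using assms by (auto simp: cat_sets_def)
  then show ?thesis
  proof (cases rule: induced_cases)
    case (one i')
    have "i # p \<in> (#) i' ` slice i' ?L" unfolding one(3) by blast
    moreover obtain q where "q \<in> B" using \<open>B \<noteq> {}\<close> by blast
    then have "j # q \<in> (#) i' ` slice i' ?L" unfolding one(3) by blast
    ultimately show ?thesis using \<open>i \<noteq> j\<close> by auto
  next
    case (many bs)
    have set_bs: "set bs = {i, j}" using many(3) ij \<open>B \<noteq> {}\<close> by (auto split: if_splits)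
    then have "length bs = 2" using many(1) \<open>i \<noteq> j\<close> by (metis card_2_iff distinct_card)
    then have "bs = [i, j] \<or> bs = [j, i]"
      using set_bs many(1) by (cases bs rule: remdups_adj.cases) (auto simp: doubleton_eq_iff)
    moreover have "isomorphic (Node []) (Node [])" by simp
    ultimately show ?thesis
      using L many(5) p B ij
      by (auto simp: cat_sets_def isomorphic_binary_iff suppress_prune_singleton)
  qed
qed

lemma card_cat_sets: "L \<in> cat_sets (Suc k) t \<Longrightarrow> card L = Suc k"
proof (induction t arbitrary: L k)
  case (Node ts)
  show ?case
  proof (cases k)
    case 0
    then show ?thesis using Node.prems by (simp add: cat_sets_1)
  next
    case (Suc k')
    from Node.prems[unfolded Suc] show ?thesis
    proof (cases rule: cat_sets_Node_cases)
      case (one i A)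
      then have "card A = Suc k" using Node.IH[of "ts ! i" A k] Suc by simp
      then show ?thesis using one by (simp add: card_image)
    next
      case (two i j p B)
      then have "card B = Suc k'" using Node.IH[of "ts ! j" B k'] by simp
      moreover from this have "finite B" by (metis card.infinite nat.simps(3))
      moreover have "i # p \<notin> (#) j ` B" using two by auto
      ultimately show ?thesis using two Suc by (simp add: card_image)
    qed
  qed
qed

lemma copies_caterpillar:
  assumes "k \<ge> 1"
  shows "copies (caterpillar k) t = card (cat_sets k t)"
proof -
  obtain k' where k: "k = Suc k'" using assms by (cases k) auto
  have "isomorphic (induced t L) (caterpillar k) \<longleftrightarrow>
      isomorphic (suppress (prune t L)) (caterpillar k)" if "L \<subseteq> leaves t" "L \<noteq> {}" for L
    using that by (simp add: induced_eq_suppress_prune)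
  moreover have "card L = num_leaves (caterpillar k)" if "L \<in> cat_sets k t" for L
    using card_cat_sets that k num_leaves_caterpillar[OF assms] by simp
  moreover have "L \<noteq> {}" if "card L = num_leaves (caterpillar k)" for L :: "nat list set"
    using that num_leaves_caterpillar[OF assms] assms by auto
  ultimately have "{L. L \<subseteq> leaves t \<and> card L = num_leaves (caterpillar k) \<and>
      isomorphic (induced t L) (caterpillar k)} = cat_sets k t"
    unfolding cat_sets_def by blast
  then show ?thesis by (simp add: copies_def)
qed

text \<open>Any two leaves induce the two-leaf caterpillar: descend while both lie in the same
  branch; where they part, each contributes a single leaf.\<close>

lemma cat_sets_2: "cat_sets 2 t = {L. L \<subseteq> leaves t \<and> card L = 2}"
proof -
  have "L \<in> cat_sets (Suc (Suc 0)) t" if "L \<subseteq> leaves t" "card L = 2" for L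
    using that
  proof (induction t arbitrary: L)
    case (Node ts)
    have "L \<noteq> {}" "ts \<noteq> []"
      using Node.prems card_mono[of "{[]}" L] by auto
    with Node.prems(1) show ?case
    proof (cases rule: induced_cases)
      case (one i)
      have "card (slice i L) = 2" using one(3) Node.prems(2) by (metis card_image inj_on_Cons1)
      then have "slice i L \<in> cat_sets (Suc (Suc 0)) (ts ! i)"
        using one Node.prems by (intro Node.IH slice_leaves) auto
      then show ?thesis using cat_sets_Node_oneI[OF one(1)] one(3) by metis
    next
      case (many bs)
      then obtain i j where ij: "i \<in> set bs" "j \<in> set bs" "i \<noteq> j"
        by (cases bs rule: remdups_adj.cases) auto
      then obtain p q where pq: "i # p \<in> L" "j # q \<in> L"
        using many(3) by (auto simp: slice_def)
      have "finite L" using Node.prems finite_leaves finite_subset by blast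
      then have "L = {i # p, j # q}"
        using pq Node.prems(2) ij by (intro card_seteq[symmetric]) auto
      then show ?thesis
        using cat_sets_Node_twoI[of i ts j p "{q}" 0] ij(3) Node.prems(1) by simp
    qed
  qed
  then show ?thesis
    using card_cat_sets[of _ 1 t] by (auto simp: numeral_2_eq_2 cat_sets_def)
qed

section \<open>Leaf counts and the recursion for the number of copies\<close>

lemma card_cat_sets_2: "card (cat_sets 2 t) = num_leaves t choose 2"
  by (simp add: cat_sets_2 n_subsets finite_leaves num_leaves_def)

lemma num_leaves_leaf [simp]: "num_leaves (Node []) = 1"
  by (simp add: num_leaves_def)

lemma num_leaves_Node:
  assumes "ts \<noteq> []"
  shows "num_leaves (Node ts) = (\<Sum>i<length ts. num_leaves (ts ! i))"
  unfolding num_leaves_def using assms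
  by (simp add: leaves_Node) (subst card_UN_disjoint, auto simp: finite_leaves card_image)

lemma num_leaves_pos: "num_leaves t > 0"
proof (induction t)
  case (Node ts)
  then show ?case
    by (cases "ts = []") (auto simp: num_leaves_Node intro!: sum_pos)
qed

text \<open>\<open>X\<close> collects the copies inside one branch. \<open>P\<close> parametrizes
  the others: a smaller caterpillar \<open>B\<close> in branch \<open>j\<close> and a leaf
  \<open>p\<close> in another branch \<open>i\<close>. Starting at three leaves matters: for two
  leaves the roles of \<open>i\<close> and \<open>j\<close> could be exchanged, and each copy would
  be counted twice.\<close>

lemma card_cat_sets_Node:
  assumes "ts \<noteq> []"
  shows "card (cat_sets (Suc (Suc (Suc k))) (Node ts)) =
    (\<Sum>i<length ts. card (cat_sets (Suc (Suc (Suc k))) (ts ! i))) +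
    (\<Sum>j<length ts. (num_leaves (Node ts) - num_leaves (ts ! j)) * card (cat_sets (Suc (Suc k)) (ts ! j)))"
proof -
  let ?n = "length ts"
  define X where "X = (\<Union>i<?n. image ((#) i) ` cat_sets (Suc (Suc (Suc k))) (ts ! i))"
  define P where "P = (SIGMA j:{..<?n}. cat_sets (Suc (Suc k)) (ts ! j) \<times>
      (SIGMA i:{..<?n} - {j}. leaves (ts ! i)))"
  define F where "F = (\<lambda>(j, B, i, p). insert (i # p) ((#) j ` B) :: nat list set)"
  have P_iff: "(j, B, i, p) \<in> P \<longleftrightarrow> j < ?n \<and> B \<in> cat_sets (Suc (Suc k)) (ts ! j) \<and>
      i < ?n \<and> i \<noteq> j \<and> p \<in> leaves (ts ! i)" for j B i p
    by (auto simp: P_def)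
  have "cat_sets (Suc (Suc (Suc k))) (Node ts) = X \<union> F ` P"
  proof (intro equalityI subsetI)
    fix L assume "L \<in> cat_sets (Suc (Suc (Suc k))) (Node ts)"
    then show "L \<in> X \<union> F ` P"
    proof (cases rule: cat_sets_Node_cases)
      case (one i A)
      then show ?thesis by (auto simp: X_def)
    next
      case (two i j p B)
      then have "(j, B, i, p) \<in> P" "F (j, B, i, p) = L" by (auto simp: P_iff F_def)
      then show ?thesis by blast
    qed
  next
    fix L assume "L \<in> X \<union> F ` P"
    then show "L \<in> cat_sets (Suc (Suc (Suc k))) (Node ts)"
      by (auto simp: X_def P_iff F_def intro: cat_sets_Node_oneI cat_sets_Node_twoI)
  qed
  moreover have finP: "finite P" by (simp add: P_def finite_leaves)
  moreover have "finite X" by (simp add: X_def)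
  \<comment> \<open>A set in \<open>X\<close> meets one branch only, whereas a value of
    \<open>F\<close> on \<open>P\<close> meets both \<open>i\<close> and \<open>j\<close>.\<close>
  moreover have "X \<inter> F ` P = {}"
  proof -
    have False if "(j, B, i, p) \<in> P" "F (j, B, i, p) = (#) l ` A" for j B i p l A
    proof -
      have "B \<noteq> {}" "i \<noteq> j" using that(1) by (auto simp: P_iff cat_sets_def)
      moreover have "slice i ((#) l ` A) \<noteq> {}" "slice j ((#) l ` A) \<noteq> {}"
        using \<open>B \<noteq> {}\<close> by (simp_all flip: that(2) add: F_def)
      ultimately show False by (auto split: if_splits)
    qed
    then show ?thesis by (auto simp: X_def)
  qed
  moreover have "card X = (\<Sum>i<?n. card (cat_sets (Suc (Suc (Suc k))) (ts ! i)))"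
  proof -
    have "(#) i ` A \<noteq> (#) j ` B" if "A \<in> cat_sets m t" "i \<noteq> j" for i j A B m t
      using that by (auto simp: cat_sets_def)
    moreover have "inj_on (image ((#) i)) U" for i :: nat and U
      by (intro inj_onI) (simp add: inj_image_eq_iff)
    ultimately show ?thesis
      unfolding X_def by (subst card_UN_disjoint) (auto simp: card_image)
  qed
  moreover have "card (F ` P) = card P"
  proof (intro card_image inj_onI)
    fix x y assume xy: "x \<in> P" "y \<in> P" "F x = F y"
    obtain j B i p where x: "x = (j, B, i, p)" by (metis prod_cases4)
    obtain j' B' i' p' where y: "y = (j', B', i', p')" by (metis prod_cases4)
    define L where "L = F x"
    have sx: "slice l L = (if l = j then B else if l = i then {p} else {})" for l
      using xy(1) unfolding L_def x P_iff by (auto simp: F_def)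
    have sy: "slice l L = (if l = j' then B' else if l = i' then {p'} else {})" for l
      using xy(2) unfolding L_def xy(3) y P_iff by (auto simp: F_def)
    have cards: "card B = Suc (Suc k)" "card B' = Suc (Suc k)"
      using xy card_cat_sets by (auto simp: x y P_iff)
    have ne: "i \<noteq> j" "i' \<noteq> j'" using xy by (auto simp: x y P_iff)
    \<comment> \<open>Branch \<open>j\<close> is recognizable from \<open>L\<close>: its slice has
      at least two elements, while every slice other than that of \<open>j'\<close> has at most
      one.\<close>
    have j: "j = j'"
    proof (rule ccontr)
      assume "j \<noteq> j'"
      then have "card (slice j L) \<le> 1" unfolding sy by simp
      moreover have "card (slice j L) = Suc (Suc k)" unfolding sx using cards by simp
      ultimately show False by simp
    qed
    moreover have "B = B'" using sx[of j] sy[of j] j by simp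
    moreover have "i = i'" by (rule ccontr) (use sx[of i] sy[of i] j ne in simp)
    moreover have "p = p'" using sx[of i] sy[of i] j ne \<open>i = i'\<close> by auto
    ultimately show "x = y" using x y by simp
  qed
  moreover have "card P = (\<Sum>j<?n. (num_leaves (Node ts) - num_leaves (ts ! j)) *
      card (cat_sets (Suc (Suc k)) (ts ! j)))"
  proof -
    have "num_leaves (Node ts) - num_leaves (ts ! j) = (\<Sum>i\<in>{..<?n} - {j}. num_leaves (ts ! i))"
      if "j < ?n" for j
      using that assms by (simp add: num_leaves_Node sum_diff1_nat)
    then show ?thesis
      unfolding P_def
      by (simp add: card_SigmaI card_cartesian_product finite_leaves num_leaves_def mult.commute)
  qed
  ultimately show ?thesis by (simp add: card_Un_disjoint)
qed

subsection \<open>Bounds on the number of copies\<close>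

lemma card_cat_sets_Node_real:
  fixes ts :: "rtree list" and k :: nat
  assumes "ts \<noteq> []" "k \<ge> 2"
  defines "x \<equiv> \<lambda>i. real (num_leaves (ts ! i))" and "N \<equiv> real (num_leaves (Node ts))"
  shows "real (card (cat_sets (Suc k) (Node ts))) =
    (\<Sum>i<length ts. real (card (cat_sets (Suc k) (ts ! i)))) +
    (\<Sum>j<length ts. (N - x j) * real (card (cat_sets k (ts ! j))))"
proof -
  obtain k' where k: "k = Suc (Suc k')" using assms(2) by (metis add_2_eq_Suc le_Suc_ex)
  have "num_leaves (ts ! j) \<le> num_leaves (Node ts)" if "j < length ts" for j
    unfolding num_leaves_Node[OF assms(1)] using that by (intro member_le_sum) auto
  then show ?thesis
    unfolding k card_cat_sets_Node[OF assms(1)] x_def N_def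
    by (simp add: of_nat_diff)
qed

lemma card_cat_sets_leaf: "k \<ge> 2 \<Longrightarrow> card (cat_sets k (Node [])) = 0"
  by (cases k rule: caterpillar.cases) auto

lemma real_choose_two: "real (n choose 2) = real n ^ 2 / 2 - real n / 2"
  by (induction n) (simp_all add: numeral_2_eq_2 field_simps)

section \<open>The lower bound for arbitrary trees\<close>

text \<open>The outer induction is on \<open>k\<close>, the inner one on the tree. The correction
  \<open>N ^ (k - 1) / 2\<close> is exact for \<open>k = 2\<close>, covers the single leaf, and
  reproduces itself at a vertex; the leading terms are compared in \<open>main\<close>, the
  corrections in \<open>err\<close>.\<close>

lemma card_cat_sets_lower_bound:
  assumes "d > 0" "dary d t" "k \<ge> 2"
  shows "cat_density d k * real (num_leaves t) ^ k - real (num_leaves t) ^ (k - 1) / 2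
    \<le> real (card (cat_sets k t))"
  using \<open>k \<ge> 2\<close> \<open>dary d t\<close>
proof (induction k arbitrary: t rule: dec_induct)
  case base
  show ?case by (simp add: card_cat_sets_2 real_choose_two)
next
  case (step k)
  then obtain m where m: "k = Suc (Suc m)" by (metis add_2_eq_Suc le_Suc_ex)
  from step.prems show ?case
  proof (induction t)
    case (Node ts)
    show ?case
    proof (cases "ts = []")
      case True
      then show ?thesis using cat_density_le[OF assms(1), of "Suc k"] by simp
    next
      case False
      define x N where "x = (\<lambda>i. real (num_leaves (ts ! i)))" and "N = real (num_leaves (Node ts))"
      let ?a = "cat_density d (Suc k)" and ?n = "length ts"
      have card: "card {..<?n} \<le> d" and dary: "\<And>i. i < ?n \<Longrightarrow> dary d (ts ! i)"
        using Node.prems by (auto simp: dary_Node)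
      have N: "N = sum x {..<?n}" using False by (simp add: N_def x_def num_leaves_Node)
      have le: "x i \<le> N" if "i < ?n" for i
        unfolding N using that by (intro member_le_sum) (auto simp: x_def)
      have main: "?a * (N ^ Suc k - (\<Sum>i<?n. x i ^ Suc k))
          \<le> (\<Sum>j<?n. (N - x j) * (cat_density d k * x j ^ k))"
      proof -
        have "N ^ Suc k - (\<Sum>i<?n. x i ^ Suc k)
            \<le> (\<Sum>i<k. real d ^ i) * (\<Sum>i<?n. x i ^ k * (N - x i))"
          using card N assms m by (intro power_sum_defect_le) (auto simp: x_def)
        then have "?a * (N ^ Suc k - (\<Sum>i<?n. x i ^ Suc k))
            \<le> ?a * (\<Sum>i<k. real d ^ i) * (\<Sum>i<?n. x i ^ k * (N - x i))"
          by (simp add: mult_left_mono mult.assoc del: power_Suc)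
        also have "\<dots> = (\<Sum>j<?n. (N - x j) * (cat_density d k * x j ^ k))"
          using cat_density_Suc[OF assms(1), of k] m by (simp add: sum_distrib_left mult_ac)
        finally show ?thesis .
      qed
      \<comment> \<open>The two corrections from branch \<open>j\<close> add up to
        \<open>N * x j ^ (k - 1) / 2\<close>. Bounding all but one factor \<open>x j\<close> by
        \<open>N\<close> and summing gives \<open>N ^ k / 2\<close>.\<close>
      have err: "(\<Sum>j<?n. (N - x j) * (x j ^ (k - 1) / 2)) + (\<Sum>i<?n. x i ^ k) / 2 \<le> N ^ k / 2"
      proof -
        have "(\<Sum>j<?n. (N - x j) * (x j ^ (k - 1) / 2)) + (\<Sum>i<?n. x i ^ k) / 2 =
            (\<Sum>j<?n. N * x j ^ (k - 1)) / 2"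
          by (simp add: m sum_divide_distrib sum.distrib[symmetric] field_simps)
        also have "\<dots> \<le> (\<Sum>j<?n. N * (N ^ m * x j)) / 2"
        proof (intro divide_right_mono sum_mono mult_left_mono)
          fix j assume "j \<in> {..<?n}"
          then have "x j ^ m * x j \<le> N ^ m * x j"
            using le[of j] by (intro mult_right_mono power_mono) (auto simp: x_def)
          then show "x j ^ (k - 1) \<le> N ^ m * x j" by (simp add: m mult.commute)
        qed (auto simp: N_def)
        also have "(\<Sum>j<?n. N * (N ^ m * x j)) = N * (N ^ m * sum x {..<?n})"
          by (simp add: sum_distrib_left)
        also have "\<dots> / 2 = N ^ k / 2"
          by (simp add: m flip: N)
        finally show ?thesis .
      qed
      have "?a * N ^ Suc k - N ^ k / 2 \<le> (\<Sum>i<?n. ?a * x i ^ Suc k - x i ^ k / 2) +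
          (\<Sum>j<?n. (N - x j) * (cat_density d k * x j ^ k - x j ^ (k - 1) / 2))"
        using main err
        by (simp add: sum.distrib sum_subtractf right_diff_distrib sum_distrib_left
            sum_divide_distrib del: power_Suc)
      also have "\<dots> \<le> (\<Sum>i<?n. real (card (cat_sets (Suc k) (ts ! i)))) +
          (\<Sum>j<?n. (N - x j) * real (card (cat_sets k (ts ! j))))"
      proof (intro add_mono sum_mono mult_left_mono)
        fix i assume i: "i \<in> {..<?n}"
        then show "?a * x i ^ Suc k - x i ^ k / 2 \<le> real (card (cat_sets (Suc k) (ts ! i)))"
          using Node.IH[of "ts ! i"] dary[of i] by (simp add: x_def)
        show "cat_density d k * x i ^ k - x i ^ (k - 1) / 2 \<le> real (card (cat_sets k (ts ! i)))"
          using step.IH[of "ts ! i"] dary[of i] i by (simp add: x_def)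
        show "0 \<le> N - x i" using le i by simp
      qed
      also have "\<dots> = real (card (cat_sets (Suc k) (Node ts)))"
        using card_cat_sets_Node_real[OF False step.hyps(1)] by (simp add: x_def N_def)
      finally show ?thesis by (simp add: N_def)
    qed
  qed
qed

section \<open>The upper bound from balanced trees\<close>

text \<open>
  Measuring a tree by its number of leaves minus one, each child of a balanced vertex is at most
  \<open>1 / d\<close> of its parent, without a rounding error.
\<close>

primrec balanced :: "nat \<Rightarrow> rtree \<Rightarrow> bool" where
  "balanced d (Node ts) \<longleftrightarrow>
     (\<forall>t \<in> set ts. d * (num_leaves t - 1) \<le> num_leaves (Node ts) - 1) \<and> list_all (balanced d) ts"

lemma num_leaves_Node_sum_list:
  "ts \<noteq> [] \<Longrightarrow> num_leaves (Node ts) = sum_list (map num_leaves ts)"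
  by (simp add: num_leaves_Node sum_list_sum_nth atLeast0LessThan)

lemma balanced_tree_exists:
  assumes d: "d \<ge> 2"
  shows "n \<ge> 1 \<Longrightarrow> \<exists>t. dary d t \<and> num_leaves t = n \<and> balanced d t"
proof (induction n rule: less_induct)
  case (less n)
  show ?case
  proof (cases "n = 1")
    case True
    then show ?thesis by (intro exI[of _ "Node []"]) (simp add: dary_Node)
  next
    case False
    \<comment> \<open>The root gets \<open>d\<close> branches, or \<open>n\<close> single leaves if
      \<open>n < d\<close>. Of the \<open>r\<close> branches, \<open>s\<close> have
      \<open>q + 1\<close> leaves and the rest have \<open>q\<close>.\<close>
    define r where "r = min n d"
    define q s where "q = n div r" and "s = n mod r"
    have r: "2 \<le> r" "r \<le> d" "r \<le> n" using False less.prems d by (auto simp: r_def)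
    have n: "n = r * q + s" and s: "s < r" using r by (auto simp: q_def s_def)
    have q1: "q \<ge> 1" using r by (simp add: q_def div_greater_zero_iff Suc_le_eq)
    have "2 * q \<le> r * q" using r by simp
    then have qn: "q < n" and qn': "s > 0 \<Longrightarrow> q + 1 < n" using q1 n by linarith+
    obtain t where t: "dary d t" "num_leaves t = q" "balanced d t"
      using less.IH[OF qn q1] by blast
    \<comment> \<open>The larger branch is requested only for \<open>s > 0\<close>: otherwise
      \<open>q + 1 < n\<close> may fail, as for \<open>n = 2\<close>.\<close>
    have "\<exists>u. s > 0 \<longrightarrow> dary d u \<and> num_leaves u = q + 1 \<and> balanced d u"
      using less.IH[of "q + 1"] qn' by auto
    then obtain u where u: "s > 0 \<Longrightarrow> dary d u" "s > 0 \<Longrightarrow> num_leaves u = q + 1"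
      "s > 0 \<Longrightarrow> balanced d u" by blast
    define ts where "ts = replicate s u @ replicate (r - s) t"
    have len: "length ts = r" using s by (simp add: ts_def)
    have ts_mem: "v \<in> set ts \<longleftrightarrow> s > 0 \<and> v = u \<or> v = t" for v
      using s by (auto simp: ts_def)
    have ne: "ts \<noteq> []" using len r by auto
    have "s * (q + 1) + (r - s) * q = n"
      using s n by (simp add: algebra_simps diff_mult_distrib)
    then have leaves: "num_leaves (Node ts) = n"
      unfolding num_leaves_Node_sum_list[OF ne] using u(2) t(2)
      by (cases "s > 0") (auto simp: ts_def sum_list_replicate)
    have "dary d (Node ts)"
      using r len t(1) u(1) ts_mem nth_mem[of _ ts] by (fastforce simp: dary_Node)
    moreover have "balanced d (Node ts)"
    proof -
      \<comment> \<open>For \<open>r = d\<close>, a positive remainder gives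
        \<open>d * q = n - s \<le> n - 1\<close>. For \<open>r = n\<close>, all branches are leaves
        and \<open>s = 0\<close>.\<close>
      have "d * (q - 1) \<le> n - 1 \<and> (s > 0 \<longrightarrow> d * q \<le> n - 1)"
      proof (cases "d \<le> n")
        case True
        then have "r = d" by (simp add: r_def)
        then show ?thesis using n d q1 by (auto simp: diff_mult_distrib2)
      next
        case False
        then have "r = n" by (simp add: r_def)
        then show ?thesis using r by (simp add: q_def s_def)
      qed
      then show ?thesis using t u ts_mem leaves by (auto simp: list_all_iff)
    qed
    ultimately show ?thesis using leaves by blast
  qed
qed

text \<open>With \<open>M\<close> leaves minus one at a vertex, balance bounds the same measure in
  every branch by \<open>y = M / d\<close>. All branches are replaced by this worst case, and the
  outside leaf counts sum to at most \<open>(d - 1) * N\<close>. The leading terms then match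
  exactly, and \<open>c\<close> absorbs the rest.\<close>

lemma card_cat_sets_upper_bound:
  assumes d: "d \<ge> 2" and "k \<ge> 2"
  shows "\<exists>c\<ge>0. \<forall>t. dary d t \<longrightarrow> balanced d t \<longrightarrow> real (card (cat_sets k t)) \<le>
    cat_density d k * real (num_leaves t - 1) ^ k + c * real (num_leaves t - 1) ^ (k - 1)"
  using \<open>k \<ge> 2\<close>
proof (induction k rule: dec_induct)
  case base
  have "real (n choose 2) = (1 / 2) * real (n - 1) ^ 2 + (1 / 2) * real (n - 1) ^ (2 - 1)" for n
    by (cases n) (simp_all add: real_choose_two field_simps power2_eq_square)
  then show ?case
    by (intro exI[of _ "1 / 2"]) (auto simp: card_cat_sets_2)
next
  case (step k)
  let ?a = "cat_density d (Suc k)" and ?b = "cat_density d k"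
  obtain m where m: "k = Suc (Suc m)" using step.hyps by (metis add_2_eq_Suc le_Suc_ex)
  obtain c where c: "c \<ge> 0" and IH: "\<And>t. dary d t \<Longrightarrow> balanced d t \<Longrightarrow>
      real (card (cat_sets k t)) \<le> ?b * real (num_leaves t - 1) ^ k + c * real (num_leaves t - 1) ^ (k - 1)"
    using step.IH by blast
  \<comment> \<open>The terms of order \<open>y ^ k\<close> must fit into \<open>c' * M ^ k\<close>,
    which is at least \<open>d ^ 2 * c' * y ^ k\<close>. After cancelling \<open>d - 1\<close> this
    requires \<open>?b + 2 * d * c \<le> d * c'\<close>.\<close>
  define c' where "c' = d * (?b + 2 * c)"
  have c': "c' \<ge> 0" using c by (simp add: c'_def)
  have "real (card (cat_sets (Suc k) t)) \<le>
      ?a * real (num_leaves t - 1) ^ Suc k + c' * real (num_leaves t - 1) ^ k"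
    if "dary d t" "balanced d t" for t
    using that
  proof (induction t)
    case (Node ts)
    show ?case
    proof (cases "ts = []")
      case True
      then show ?thesis using step.hyps c' by (simp add: card_cat_sets_leaf)
    next
      case False
      define x N where "x = (\<lambda>i. real (num_leaves (ts ! i)))" and "N = real (num_leaves (Node ts))"
      define M y where "M = real (num_leaves (Node ts) - 1)" and "y = M / d"
      let ?n = "length ts"
      have n: "2 \<le> ?n" "?n \<le> d" and dary: "\<And>i. i < ?n \<Longrightarrow> dary d (ts ! i)"
        using Node.prems False by (auto simp: dary_Node)
      have bal: "\<And>i. i < ?n \<Longrightarrow> balanced d (ts ! i)"
        using Node.prems by (simp add: list_all_length)
      have N: "N = sum x {..<?n}" using False by (simp add: N_def x_def num_leaves_Node)
      have "(\<Sum>i<?n. 1) \<le> sum x {..<?n}"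
        using num_leaves_pos by (intro sum_mono) (simp add: x_def Suc_le_eq)
      then have N2: "N \<ge> 2" using n by (simp add: N)
      then have M: "N = M + 1" "M \<ge> 1" by (auto simp: N_def M_def)
      have y: "0 \<le> y" using M by (simp add: y_def)
      have M_y: "M = d * y" using d by (simp add: y_def)
      have le: "x i \<le> N" if "i < ?n" for i
        unfolding N using that by (intro member_le_sum) (auto simp: x_def)
      have child: "real (num_leaves (ts ! i) - 1) \<le> y" if "i < ?n" for i
      proof -
        have "d * (num_leaves (ts ! i) - 1) \<le> num_leaves (Node ts) - 1"
          using Node.prems(2) that by simp
        then have "real d * real (num_leaves (ts ! i) - 1) \<le> M"
          unfolding M_def of_nat_mult[symmetric] of_nat_le_iff .
        then show ?thesis using d by (simp add: y_def field_simps)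
      qed
      have "real (card (cat_sets (Suc k) (Node ts))) =
          (\<Sum>i<?n. real (card (cat_sets (Suc k) (ts ! i)))) +
          (\<Sum>j<?n. (N - x j) * real (card (cat_sets k (ts ! j))))"
        using card_cat_sets_Node_real[OF False step.hyps(1)] by (simp add: x_def N_def)
      also have "\<dots> \<le> (\<Sum>i<?n. ?a * y ^ Suc k + c' * y ^ k) +
          (\<Sum>j<?n. (N - x j) * (?b * y ^ k + c * y ^ (k - 1)))"
      proof (intro add_mono sum_mono mult_left_mono)
        fix i assume i: "i \<in> {..<?n}"
        have "real (card (cat_sets (Suc k) (ts ! i))) \<le>
            ?a * real (num_leaves (ts ! i) - 1) ^ Suc k + c' * real (num_leaves (ts ! i) - 1) ^ k"
          using Node.IH[of "ts ! i"] dary bal i by simp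
        also have "\<dots> \<le> ?a * y ^ Suc k + c' * y ^ k"
          using child i c' by (intro add_mono mult_left_mono power_mono) auto
        finally show "real (card (cat_sets (Suc k) (ts ! i))) \<le> ?a * y ^ Suc k + c' * y ^ k" .
        have "real (card (cat_sets k (ts ! i))) \<le>
            ?b * real (num_leaves (ts ! i) - 1) ^ k + c * real (num_leaves (ts ! i) - 1) ^ (k - 1)"
          using IH dary bal i by simp
        also have "\<dots> \<le> ?b * y ^ k + c * y ^ (k - 1)"
          using child i c by (intro add_mono mult_left_mono power_mono) auto
        finally show "real (card (cat_sets k (ts ! i))) \<le> ?b * y ^ k + c * y ^ (k - 1)" .
        show "0 \<le> N - x i" using le i by simp
      qed
      also have "\<dots> = ?n * (?a * y ^ Suc k + c' * y ^ k) +
          (?n - 1) * N * (?b * y ^ k + c * y ^ (k - 1))"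
      proof -
        have "(\<Sum>j<?n. N - x j) = (?n - 1) * N"
          using n by (simp add: sum_subtractf of_nat_diff left_diff_distrib flip: N)
        then show ?thesis by (simp flip: sum_distrib_right)
      qed
      also have "\<dots> \<le> d * (?a * y ^ Suc k + c' * y ^ k) +
          (d - 1) * N * (?b * y ^ k + c * y ^ (k - 1))"
        using n y c c' N2 by (intro add_mono mult_right_mono add_nonneg_nonneg) auto
      also have "\<dots> \<le> ?a * M ^ Suc k + c' * M ^ k"
      proof -
        \<comment> \<open>The density recursion gives \<open>?a + (d - 1) * ?b = ?a * d ^ k\<close>,
          so the terms of order \<open>y ^ (k + 1)\<close> add up to exactly
          \<open>?a * M ^ (k + 1)\<close>.\<close>
        have "(d - 1) * ?b = ?a * (real d ^ k - 1)"
          using d cat_density_Suc[of d k] m by (simp add: geometric_sum of_nat_diff field_simps)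
        then have "d * y ^ Suc k * (?a + (d - 1) * ?b) = d * y ^ Suc k * (?a * real d ^ k)"
          by (simp add: right_diff_distrib del: power_Suc)
        then have "d * (?a * y ^ Suc k) + (d - 1) * M * (?b * y ^ k) = ?a * M ^ Suc k"
          unfolding M_y by (simp add: power_mult_distrib distrib_left mult_ac)
        \<comment> \<open>Since \<open>M \<ge> 1\<close>, the factor \<open>M + 1\<close> is at most
          \<open>2 * M = 2 * d * y\<close>; this raises the power of \<open>y\<close> to
          \<open>k\<close>.\<close>
        moreover have "(d - 1) * (M + 1) * (c * y ^ (k - 1)) \<le> (d - 1) * (2 * d * y) * (c * y ^ (k - 1))"
          using M(2) c y M_y by (intro mult_right_mono mult_left_mono) (auto simp: mult.commute)
        then have "(d - 1) * (M + 1) * (c * y ^ (k - 1)) \<le> (d - 1) * (2 * d * c) * y ^ k"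
          by (simp add: m mult_ac)
        moreover have "d * c' * y ^ k + (d - 1) * ?b * y ^ k + (d - 1) * (2 * d * c) * y ^ k
            \<le> c' * M ^ k"
        proof -
          have "1 \<le> real d ^ 2" "real d \<le> real d ^ 2"
            using d power_increasing[of 0 2 "real d"] power_increasing[of 1 2 "real d"] by simp_all
          then have "1 * ?b \<le> real d ^ 2 * ?b" "real d * c \<le> real d ^ 2 * c"
            using c by (intro mult_right_mono; simp)+
          then have "?b + 2 * d * c \<le> d * c'"
            by (simp add: c'_def power2_eq_square algebra_simps)
          then have "(real d - 1) * (?b + 2 * d * c) \<le> (real d - 1) * (d * c')"
            using d by (intro mult_left_mono) auto
          then have "d * c' + (d - 1) * ?b + (d - 1) * (2 * d * c) \<le> real d ^ 2 * c'"
            using d by (simp add: of_nat_diff power2_eq_square algebra_simps)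
          also have "\<dots> \<le> real d ^ k * c'"
            using d c' m by (intro mult_right_mono power_increasing) auto
          finally have "(d * c' + (d - 1) * ?b + (d - 1) * (2 * d * c)) * y ^ k \<le> real d ^ k * c' * y ^ k"
            using y by (intro mult_right_mono) auto
          then show ?thesis by (simp add: M_y power_mult_distrib algebra_simps)
        qed
        ultimately show ?thesis unfolding M(1) by (simp add: algebra_simps)
      qed
      finally show ?thesis by (simp add: M_def)
    qed
  qed
  then show ?case using c' by auto
qed


section \<open>Combining both bounds into the asymptotic formula\<close>

theorem corollary3:
  fixes d k :: nat
  assumes "d \<ge> 2" and "k \<ge> 2"
  shows "(\<lambda>n. real (Min {copies (caterpillar k) T | T. dary d T \<and> num_leaves T = n})
            - real n ^ k / 2 * (real d - 1) ^ (k - 1) * inverse (\<Prod>j = 1..k - 1. (real d ^ j - 1)))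
         \<in> O(\<lambda>n. real n ^ (k - 1))"
proof -
  let ?a = "cat_density d k"
  obtain c where c: "c \<ge> 0" and upper: "\<And>t. dary d t \<Longrightarrow> balanced d t \<Longrightarrow>
      real (card (cat_sets k t)) \<le> ?a * real (num_leaves t - 1) ^ k + c * real (num_leaves t - 1) ^ (k - 1)"
    using card_cat_sets_upper_bound[OF assms] by blast
  have copies: "copies (caterpillar k) t = card (cat_sets k t)" for t
    using assms(2) by (simp add: copies_caterpillar)
  \<comment> \<open>No tree has zero leaves, so the estimate starts at \<open>n = 1\<close>. The
    constant \<open>c + 1\<close> exceeds both the upper error constant \<open>c\<close> and the
    lower one \<open>1 / 2\<close>.\<close>
  have "\<bar>real (Min {copies (caterpillar k) T | T. dary d T \<and> num_leaves T = n}) - ?a * real n ^ k\<bar>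
      \<le> (c + 1) * real n ^ (k - 1)" if n: "n \<ge> 1" for n
  proof -
    let ?S = "{copies (caterpillar k) T | T. dary d T \<and> num_leaves T = n}"
    have "Min ?S \<in> ?S"
      using finite_copies copies_nonempty[OF assms(1) n] by (rule Min_in)
    then obtain t where t: "dary d t" "num_leaves t = n" "Min ?S = card (cat_sets k t)"
      by (auto simp: copies)
    have lower: "?a * real n ^ k - real n ^ (k - 1) / 2 \<le> real (Min ?S)"
      using card_cat_sets_lower_bound[OF _ t(1) assms(2)] t assms(1) by simp
    obtain u where u: "dary d u" "num_leaves u = n" "balanced d u"
      using balanced_tree_exists[OF assms(1) n] by blast
    have "Min ?S \<le> card (cat_sets k u)"
      using u by (intro Min_le finite_copies) (auto simp: copies)
    then have "real (Min ?S) \<le> ?a * real (n - 1) ^ k + c * real (n - 1) ^ (k - 1)"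
      using upper[OF u(1,3)] u(2) by simp
    also have "\<dots> \<le> ?a * real n ^ k + c * real n ^ (k - 1)"
      using c by (intro add_mono mult_left_mono power_mono) auto
    finally have "real (Min ?S) \<le> ?a * real n ^ k + c * real n ^ (k - 1)" .
    moreover have "0 \<le> real n ^ (k - 1)" "0 \<le> c * real n ^ (k - 1)" using c by simp_all
    ultimately show ?thesis using lower unfolding distrib_right abs_le_iff by linarith
  qed
  then have "(\<lambda>n. real (Min {copies (caterpillar k) T | T. dary d T \<and> num_leaves T = n}) - ?a * real n ^ k)
      \<in> O(\<lambda>n. real n ^ (k - 1))"
    by (intro bigoI[of _ "c + 1"] eventually_sequentiallyI[of 1]) simp
  then show ?thesis
    unfolding cat_density_eq[OF assms(1)] by (simp add: mult_ac)
qed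

end
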